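(* An axially symmetric spherical random field that is not isotropic has a single axis of symmetry. That is, if a spherical random field is not isotropic and is axially symmetric around the axis through $\mathbf{x}_0$ and its antipode and also around the axis through $\tilde{\mathbf{x}}_0$ and its antipode, then $\tilde{\mathbf{x}}_0=\pm\mathbf{x}_0$.
   Context: $\mathbb{S}^2$ is the unit sphere in $\mathbb{R}^3$. Standing assumptions: a spherical random field is a real-valued second-order random field $T$ on $\mathbb{S}^2$ with zero mean whose covariance function $C(\mathbf{x}_1,\mathbf{x}_2)=\mathbf{E}(T(\mathbf{x}_1)T(\mathbf{x}_2))$ is continuous on $\mathbb{S}^2\times\mathbb{S}^2$ and not identically constant. The field is isotropic if $C(\rho\mathbf{x}_1,\rho\mathbf{x}_2)=C(\mathbf{x}_1,\mathbf{x}_2)$ for all $\rho\in SO(3)$ and all $\mathbf{x}_1,\mathbf{x}_2\in\mathbb{S}^2$. The field is axially symmetric around the axis passing through $\mathbf{x}_0\in\mathbb{S}^2$ and its antipode if $C(\rho_{\mathbf{x}_0,\alpha}\mathbf{x}_1,\rho_{\mathbf{x}_0,\alpha}\mathbf{x}_2)=C(\mathbf{x}_1,\mathbf{x}_2)$ for all $\mathbf{x}_1,\mathbf{x}_2\in\mathbb{S}^2$ and $\alpha\in[0,2\pi)$, where $\rho_{\mathbf{x}_0,\alpha}$ is the rotation around that axis by the angle $\alpha$. *)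

theory Defs
  imports "HOL-Probability.Probability"
begin

abbreviation unit_sphere :: "(real^3) set"  (\<open>\<S>\<^sup>2\<close>)
  where "\<S>\<^sup>2 \<equiv> sphere 0 1"

text \<open>
  A field is a function on the ambient space \<open>real^3\<close>; only its values on the sphere are ever
  constrained or used.
\<close>

definition covariance :: "'a measure \<Rightarrow> (real^3 \<Rightarrow> 'a \<Rightarrow> real) \<Rightarrow> real^3 \<Rightarrow> real^3 \<Rightarrow> real"
  where "covariance M T x\<^sub>1 x\<^sub>2 = (\<integral>\<omega>. T x\<^sub>1 \<omega> * T x\<^sub>2 \<omega> \<partial>M)"

locale spherical_random_field = prob_space M
  for M :: "'a measure" +
  fixes T :: "real^3 \<Rightarrow> 'a \<Rightarrow> real"
  assumes random_variable: "x \<in> \<S>\<^sup>2 \<Longrightarrow> random_variable borel (T x)"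
    and second_order: "x \<in> \<S>\<^sup>2 \<Longrightarrow> integrable M (\<lambda>\<omega>. (T x \<omega>)\<^sup>2)"
    and zero_mean: "x \<in> \<S>\<^sup>2 \<Longrightarrow> expectation (T x) = 0"
    and continuous_covariance:
      "continuous_on (\<S>\<^sup>2 \<times> \<S>\<^sup>2) (\<lambda>(x\<^sub>1, x\<^sub>2). covariance M T x\<^sub>1 x\<^sub>2)"
    and covariance_not_constant:
      "\<not> (\<lambda>(x\<^sub>1, x\<^sub>2). covariance M T x\<^sub>1 x\<^sub>2) constant_on (\<S>\<^sup>2 \<times> \<S>\<^sup>2)"

definition isotropic :: "'a measure \<Rightarrow> (real^3 \<Rightarrow> 'a \<Rightarrow> real) \<Rightarrow> bool"
  where "isotropic M T \<longleftrightarrow>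
    (\<forall>R::real^3^3. rotation_matrix R \<longrightarrow>
      (\<forall>x\<^sub>1\<in>\<S>\<^sup>2. \<forall>x\<^sub>2\<in>\<S>\<^sup>2. covariance M T (R *v x\<^sub>1) (R *v x\<^sub>2) = covariance M T x\<^sub>1 x\<^sub>2))"

text \<open>
  Rotation by the angle \<open>\<alpha>\<close>, counterclockwise as seen from the tip of the unit vector
  \<open>x\<^sub>0\<close>, around the axis spanned by \<open>x\<^sub>0\<close> (Rodrigues' formula).
\<close>

definition axial_rotation :: "real^3 \<Rightarrow> real \<Rightarrow> real^3 \<Rightarrow> real^3"
  where "axial_rotation x\<^sub>0 \<alpha> x =
    cos \<alpha> *\<^sub>R x + sin \<alpha> *\<^sub>R cross3 x\<^sub>0 x + ((1 - cos \<alpha>) * (x\<^sub>0 \<bullet> x)) *\<^sub>R x\<^sub>0"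

lemma axial_rotation_fixes_axis:
  assumes "x\<^sub>0 \<in> \<S>\<^sup>2"
  shows "axial_rotation x\<^sub>0 \<alpha> x\<^sub>0 = x\<^sub>0"
proof -
  have "x\<^sub>0 \<bullet> x\<^sub>0 = 1" using assms by (simp add: dot_square_norm)
  then show ?thesis by (simp add: axial_rotation_def algebra_simps)
qed

lemma axial_rotation_orthogonal_to_axis:
  assumes "x\<^sub>0 \<bullet> x = 0"
  shows "axial_rotation x\<^sub>0 \<alpha> x = cos \<alpha> *\<^sub>R x + sin \<alpha> *\<^sub>R cross3 x\<^sub>0 x"
  using assms by (simp add: axial_rotation_def)

lemma linear_axial_rotation: "linear (axial_rotation x\<^sub>0 \<alpha>)"
  by (rule linearI) (simp_all add: axial_rotation_def cross_add_right cross_mult_right algebra_simps)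

lemma rotation_matrix_axial_rotation:
  assumes "x\<^sub>0 \<in> \<S>\<^sup>2"
  shows "rotation_matrix (matrix (axial_rotation x\<^sub>0 \<alpha>))"
proof -
  define a b c where abc: "a = x\<^sub>0 $ 1" "b = x\<^sub>0 $ 2" "c = x\<^sub>0 $ 3"
  define s k where sk: "s = sin \<alpha>" "k = cos \<alpha>"
  have n: "a * a + b * b + c * c = 1"
    using assms by (simp add: abc norm_eq_1 inner_vec_def sum_3)
  have t: "s * s + k * k = 1"
    unfolding sk by (simp flip: power2_eq_square)
  have "norm (axial_rotation x\<^sub>0 \<alpha> x) = norm x" for x
  proof -
    define p q r where pqr: "p = x $ 1" "q = x $ 2" "r = x $ 3"
    have "axial_rotation x\<^sub>0 \<alpha> x \<bullet> axial_rotation x\<^sub>0 \<alpha> x = x \<bullet> x"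
      unfolding axial_rotation_def cross3_def inner_vec_def
      apply (simp add: sum_3 flip: abc sk pqr)
      using n t by algebra
    then show ?thesis by (simp add: norm_eq)
  qed
  then have "orthogonal_transformation (axial_rotation x\<^sub>0 \<alpha>)"
    by (simp add: orthogonal_transformation linear_axial_rotation)
  then have o: "orthogonal_matrix (matrix (axial_rotation x\<^sub>0 \<alpha>))"
    by (simp add: orthogonal_transformation_matrix)
  have "det (matrix (axial_rotation x\<^sub>0 \<alpha>)) = 1"
    unfolding det_3 matrix_def axial_rotation_def cross3_def inner_vec_def
    apply (simp add: sum_3 axis_def flip: abc sk)
    using n t by algebra
  with o show ?thesis by (simp add: rotation_matrix_def)
qed

definition axially_symmetric :: "'a measure \<Rightarrow> (real^3 \<Rightarrow> 'a \<Rightarrow> real) \<Rightarrow> real^3 \<Rightarrow> bool"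
  where "axially_symmetric M T x\<^sub>0 \<longleftrightarrow>
    (\<forall>\<alpha>\<in>{0..<2*pi}. \<forall>x\<^sub>1\<in>\<S>\<^sup>2. \<forall>x\<^sub>2\<in>\<S>\<^sup>2.
      covariance M T (axial_rotation x\<^sub>0 \<alpha> x\<^sub>1) (axial_rotation x\<^sub>0 \<alpha> x\<^sub>2) = covariance M T x\<^sub>1 x\<^sub>2)"

end

theory Submission
  imports Defs
begin

text \<open>
  Call a unit vector an axis of \<open>C\<close> if all rotations about it preserve \<open>C\<close>. Rotating an axis
  about an axis yields an axis. If \<open>a\<close> and \<open>u\<close> are axes with \<open>a \<bullet> u = d\<close>, then rotating
  \<open>a\<close> about \<open>u\<close> produces axes at every height in \<open>{2 * d\<^sup>2 - 1..1}\<close> above the equator of \<open>a\<close>.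
  Starting from a second axis other than \<open>\<plusminus>a\<close> and iterating, the height \<open>0\<close> is reached after
  finitely many doublings of \<open>1 - d\<close>, then all heights in \<open>{-1..1}\<close>, and by rotating about \<open>a\<close>
  every unit vector is an axis. Finally, any two pairs of unit vectors with the same inner
  product are related by two rotations, so \<open>C\<close> is isotropic.
\<close>

text \<open>The angle ranges over all reals, so that angles found from a sine and cosine, or by
  \<open>arccos\<close>, can be used without checking their range.\<close>

definition is_axis :: "(real^3 \<Rightarrow> real^3 \<Rightarrow> real) \<Rightarrow> real^3 \<Rightarrow> bool"
  where "is_axis C u \<longleftrightarrow> u \<in> \<S>\<^sup>2 \<and>
    (\<forall>\<alpha>. \<forall>x\<in>\<S>\<^sup>2. \<forall>y\<in>\<S>\<^sup>2. C (axial_rotation u \<alpha> x) (axial_rotation u \<alpha> y) = C x y)"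

lemma is_axisI:
  assumes "u \<in> \<S>\<^sup>2"
    and "\<And>\<alpha> x y. x \<in> \<S>\<^sup>2 \<Longrightarrow> y \<in> \<S>\<^sup>2 \<Longrightarrow>
      C (axial_rotation u \<alpha> x) (axial_rotation u \<alpha> y) = C x y"
  shows "is_axis C u"
  using assms by (simp add: is_axis_def)

lemma is_axisD:
  assumes "is_axis C u" "x \<in> \<S>\<^sup>2" "y \<in> \<S>\<^sup>2"
  shows "C (axial_rotation u \<alpha> x) (axial_rotation u \<alpha> y) = C x y"
  using assms by (simp add: is_axis_def)

lemma is_axis_sphere: "is_axis C u \<Longrightarrow> u \<in> \<S>\<^sup>2"
  by (simp add: is_axis_def)

lemma is_axis_covariance:
  assumes "u \<in> \<S>\<^sup>2" "axially_symmetric M T u"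
  shows "is_axis (covariance M T) u"
proof (rule is_axisI)
  fix \<alpha> :: real and x y :: "real^3"
  assume xy: "x \<in> \<S>\<^sup>2" "y \<in> \<S>\<^sup>2"
  \<comment> \<open>Rodrigues' formula sees the angle only through its sine and cosine, so it may be
    reduced to the interval from 0 to 2 pi.\<close>
  obtain \<beta> where \<beta>: "0 \<le> \<beta>" "\<beta> < 2 * pi" "cos \<alpha> = cos \<beta>" "sin \<alpha> = sin \<beta>"
    using sincos_total_2pi[of "cos \<alpha>" "sin \<alpha>"] by auto
  then have "axial_rotation u \<alpha> = axial_rotation u \<beta>"
    by (simp add: axial_rotation_def fun_eq_iff)
  with assms(2) xy \<beta> show "covariance M T (axial_rotation u \<alpha> x) (axial_rotation u \<alpha> y)
      = covariance M T x y"
    by (simp add: axially_symmetric_def)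
qed (fact assms(1))

lemma axial_rotation_matrix: "matrix (axial_rotation u \<alpha>) *v x = axial_rotation u \<alpha> x"
  by (simp add: matrix_works linear_axial_rotation)

lemma inner_axial_rotation:
  assumes "u \<in> \<S>\<^sup>2"
  shows "axial_rotation u \<alpha> x \<bullet> axial_rotation u \<alpha> y = x \<bullet> y"
proof -
  have "orthogonal_transformation ((*v) (matrix (axial_rotation u \<alpha>)))"
    using rotation_matrix_axial_rotation[OF assms, of \<alpha>]
    by (simp add: rotation_matrix_def orthogonal_transformation_matrix)
  then show ?thesis
    by (simp add: orthogonal_transformation_def axial_rotation_matrix)
qed

lemma axial_rotation_sphere:
  assumes "u \<in> \<S>\<^sup>2" "x \<in> \<S>\<^sup>2"
  shows "axial_rotation u \<alpha> x \<in> \<S>\<^sup>2"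
  using inner_axial_rotation[OF assms(1), of \<alpha> x x] assms(2) by (simp add: norm_eq_1)

lemma axial_rotation_uminus_cancel:
  assumes "u \<in> \<S>\<^sup>2"
  shows "axial_rotation u \<alpha> (axial_rotation u (- \<alpha>) x) = x"
proof -
  have "u \<bullet> u = 1" using assms by (simp add: norm_eq_1)
  then have L: "cross3 u (cross3 u x) = (u \<bullet> x) *\<^sub>R u - x"
    by (simp add: Lagrange)
  define k s where ks: "k = cos \<alpha>" "s = sin \<alpha>"
  have "axial_rotation u \<alpha> (axial_rotation u (- \<alpha>) x)
      = (k\<^sup>2 + s\<^sup>2) *\<^sub>R x + (1 - (k\<^sup>2 + s\<^sup>2)) *\<^sub>R ((u \<bullet> x) *\<^sub>R u)"
    by (simp add: axial_rotation_def cross_add_right cross_mult_right Cross3.right_diff_distrib L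
        inner_add_right inner_diff_right dot_cross_self \<open>u \<bullet> u = 1\<close> flip: ks)
      (simp add: power2_eq_square algebra_simps)
  then show ?thesis by (simp add: ks)
qed

text \<open>Rodrigues' formula is built from linear operations, inner products and cross products.
  Rotations commute with all of these; for the cross product this uses determinant 1.\<close>

lemma axial_rotation_conjugate:
  assumes "u \<in> \<S>\<^sup>2"
  shows "axial_rotation (axial_rotation u \<alpha> w) \<beta> (axial_rotation u \<alpha> x)
    = axial_rotation u \<alpha> (axial_rotation w \<beta> x)"
proof -
  let ?g = "axial_rotation u \<alpha>"
  have "cross3 (?g w) (?g x) = ?g (cross3 w x)"
    using cross_rotation_matrix[OF rotation_matrix_axial_rotation[OF assms, of \<alpha>], of w x]
    by (simp add: axial_rotation_matrix)
  moreover have "?g w \<bullet> ?g x = w \<bullet> x"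
    by (rule inner_axial_rotation[OF assms])
  ultimately show ?thesis
    by (simp add: axial_rotation_def[of "?g w"] axial_rotation_def[of w]
        linear_add[OF linear_axial_rotation] linear_cmul[OF linear_axial_rotation])
qed

text \<open>By conjugation, a rotation about the moved axis is \<open>g\<close> after a rotation
  about \<open>w\<close> after the inverse of \<open>g\<close>, where \<open>g\<close> is the
  rotation about \<open>u\<close>; each factor preserves \<open>C\<close>.\<close>

lemma is_axis_axial_rotation:
  assumes u: "is_axis C u" and w: "is_axis C w"
  shows "is_axis C (axial_rotation u \<alpha> w)"
proof (rule is_axisI)
  have us: "u \<in> \<S>\<^sup>2" and ws: "w \<in> \<S>\<^sup>2"
    using u w by (auto simp: is_axis_def)
  then show "axial_rotation u \<alpha> w \<in> \<S>\<^sup>2"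
    by (rule axial_rotation_sphere)
  fix \<beta> :: real and x y :: "real^3"
  assume xy: "x \<in> \<S>\<^sup>2" "y \<in> \<S>\<^sup>2"
  let ?g = "axial_rotation u \<alpha>"
  define x' y' where "x' = axial_rotation u (- \<alpha>) x" and "y' = axial_rotation u (- \<alpha>) y"
  have s: "x' \<in> \<S>\<^sup>2" "y' \<in> \<S>\<^sup>2"
    unfolding x'_def y'_def by (rule axial_rotation_sphere[OF us]; fact xy)+
  have g: "?g x' = x" "?g y' = y"
    by (simp_all only: x'_def y'_def axial_rotation_uminus_cancel[OF us])
  have "C (axial_rotation (?g w) \<beta> x) (axial_rotation (?g w) \<beta> y)
      = C (?g (axial_rotation w \<beta> x')) (?g (axial_rotation w \<beta> y'))"
    by (simp only: axial_rotation_conjugate[OF us] flip: g)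
  also have "\<dots> = C x' y'"
    by (simp only: is_axisD[OF u] is_axisD[OF w] axial_rotation_sphere[OF ws] s)
  also have "\<dots> = C x y"
    using is_axisD[OF u s] g by metis
  finally show "C (axial_rotation (?g w) \<beta> x) (axial_rotation (?g w) \<beta> y) = C x y" .
qed

lemma axial_rotation_transitive:
  assumes a: "a \<in> \<S>\<^sup>2" and x: "x \<in> \<S>\<^sup>2" and y: "y \<in> \<S>\<^sup>2" and eq: "a \<bullet> x = a \<bullet> y"
  obtains \<alpha> where "axial_rotation a \<alpha> x = y"
proof -
  define h where "h = a \<bullet> x"
  have 1: "a \<bullet> a = 1" "x \<bullet> x = 1" "y \<bullet> y = 1"
    using a x y by (simp_all add: norm_eq_1)
  have h: "a \<bullet> x = h" "x \<bullet> a = h" "a \<bullet> y = h" "y \<bullet> a = h"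
    using eq by (simp_all add: h_def inner_commute)
  show ?thesis
  proof (cases "h\<^sup>2 = 1")
    \<comment> \<open>On a pole the circle of latitude degenerates to the point
      \<open>h *\<^sub>R a\<close>.\<close>
    case True
    have "(x - h *\<^sub>R a) \<bullet> (x - h *\<^sub>R a) = 0" "(y - h *\<^sub>R a) \<bullet> (y - h *\<^sub>R a) = 0"
      using True by (simp_all add: inner_diff_left inner_diff_right h 1 power2_eq_square)
    then have "x = y" by simp
    then have "axial_rotation a 0 x = y" by (simp add: axial_rotation_def)
    then show ?thesis by (rule that)
  next
    case False
    \<comment> \<open>\<open>m\<close> is the squared norm of \<open>cross3 a x\<close>;
      \<open>c\<close> and \<open>s\<close> will turn out to be \<open>m\<close> times the cosine
      and sine of the wanted angle.\<close>
    define m where "m = 1 - h\<^sup>2"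
    have m: "m \<noteq> 0" using False by (simp add: m_def)
    define c s where "c = (y \<bullet> x - h\<^sup>2)" and "s = (y \<bullet> cross3 a x)"
    define n where "n = cross3 a x"
    have n: "n \<bullet> a = 0" "a \<bullet> n = 0" "n \<bullet> x = 0" "x \<bullet> n = 0" "n \<bullet> n = m"
      by (simp_all add: n_def m_def dot_cross_self dot_cross h 1 power2_eq_square)
    have "cross3 n a = x - h *\<^sub>R a" "cross3 n x = h *\<^sub>R x - a"
      by (simp_all add: n_def cross_skew[of "cross3 a x"] Lagrange h 1)
    moreover have "cross3 y n = (y \<bullet> x) *\<^sub>R a - h *\<^sub>R x"
      by (simp add: n_def Lagrange h)
    \<comment> \<open>Evaluating this double product in two ways expresses
      \<open>m *\<^sub>R y\<close> through \<open>x\<close>, \<open>n\<close> and \<open>a\<close>,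
      in the shape of Rodrigues' formula.\<close>
    ultimately have "cross3 n (cross3 y n) = (y \<bullet> x) *\<^sub>R (x - h *\<^sub>R a) - h *\<^sub>R (h *\<^sub>R x - a)"
      by (simp add: Cross3.right_diff_distrib cross_mult_right)
    moreover have "cross3 n (cross3 y n) = m *\<^sub>R y - s *\<^sub>R n"
      by (simp add: Lagrange n s_def inner_commute flip: n_def)
    ultimately have id: "m *\<^sub>R y = c *\<^sub>R x + s *\<^sub>R n + ((m - c) * h) *\<^sub>R a"
      by (simp add: m_def c_def power2_eq_square algebra_simps)
    \<comment> \<open>Comparing squared norms in \<open>id\<close> gives
      \<open>c\<^sup>2 + s\<^sup>2 = m\<^sup>2\<close>. The last summand below appears because
      \<open>x\<close> and \<open>a\<close> need not be orthogonal.\<close>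
    have "m * m = (m *\<^sub>R y) \<bullet> (m *\<^sub>R y)" by (simp add: 1)
    also have "\<dots> = c * c + m * (s * s) + (m - c) * h * ((m - c) * h) + 2 * (c * ((m - c) * h * h))"
      unfolding id by (simp add: inner_add_left inner_add_right n h 1 algebra_simps)
    also have "\<dots> = m * (c * c + s * s) + m * m * (h * h)"
      by (simp add: m_def power2_eq_square algebra_simps)
    finally have "m * (m * m) = m * (c * c + s * s)"
      by (simp add: m_def power2_eq_square algebra_simps)
    with m have nrm: "c\<^sup>2 + s\<^sup>2 = m\<^sup>2" by (simp add: power2_eq_square)
    have "(c / m)\<^sup>2 + (s / m)\<^sup>2 = 1"
      using nrm m by (simp add: power_divide flip: add_divide_distrib)
    then obtain \<alpha> where \<alpha>: "c / m = cos \<alpha>" "s / m = sin \<alpha>"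
      using sincos_total_2pi by metis
    have "y = (1 / m) *\<^sub>R (m *\<^sub>R y)" using m by simp
    also have "\<dots> = axial_rotation a \<alpha> x"
      unfolding id n_def axial_rotation_def \<alpha>[symmetric] h using m
      by (simp add: scaleR_add_right diff_divide_distrib Rings.left_diff_distrib)
    finally show ?thesis by (intro that[of \<alpha>]) simp
  qed
qed

lemma is_axis_at_height:
  assumes a: "is_axis C a" and u: "is_axis C u"
    and h: "2 * (a \<bullet> u)\<^sup>2 - 1 \<le> h" "h \<le> 1"
  obtains w where "is_axis C w" "a \<bullet> w = h"
proof (cases "(a \<bullet> u)\<^sup>2 = 1")
  \<comment> \<open>Here \<open>a\<close> and \<open>u\<close> are parallel, the bounds force
    \<open>h = 1\<close>, and \<open>a\<close> itself serves.\<close>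
  case True
  with h have "a \<bullet> a = h"
    using is_axis_sphere[OF a] by (simp add: norm_eq_1)
  with a show ?thesis by (rule that)
next
  case False
  define d where "d = a \<bullet> u"
  have 1: "a \<bullet> a = 1" "u \<bullet> u = 1"
    using is_axis_sphere[OF a] is_axis_sphere[OF u] by (simp_all add: norm_eq_1)
  have "d\<^sup>2 \<le> 1"
    using Cauchy_Schwarz_ineq[of a u] by (simp add: d_def 1)
  with False have d: "1 - d\<^sup>2 > 0" by (simp add: d_def)
  \<comment> \<open>Rotating \<open>a\<close> about \<open>u\<close> by \<alpha> gives height
    \<open>d\<^sup>2 + (1 - d\<^sup>2) * cos \<alpha>\<close>; solve for \<alpha>. The bounds on
    \<open>h\<close> put the quotient between -1 and 1.\<close>
  define \<alpha> where "\<alpha> = arccos ((h - d\<^sup>2) / (1 - d\<^sup>2))"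
  have "cos \<alpha> = (h - d\<^sup>2) / (1 - d\<^sup>2)"
    unfolding \<alpha>_def using h d by (intro cos_arccos) (simp_all add: field_simps flip: d_def)
  then have c: "cos \<alpha> * (1 - d\<^sup>2) = h - d\<^sup>2" using d by simp
  have "a \<bullet> axial_rotation u \<alpha> a = cos \<alpha> * (1 - d\<^sup>2) + d\<^sup>2"
    by (simp add: axial_rotation_def inner_add_right 1 dot_cross_self inner_commute[of u a]
        power2_eq_square algebra_simps flip: d_def)
  also have "\<dots> = h" using c by simp
  finally show ?thesis by (rule that[OF is_axis_axial_rotation[OF u a]])
qed

lemma is_axis_everywhere:
  assumes a: "is_axis C a" and b: "is_axis C b" and ne: "b \<noteq> a" "b \<noteq> - a" and y: "y \<in> \<S>\<^sup>2"
  shows "is_axis C y"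
proof -
  define d where "d = a \<bullet> b"
  \<comment> \<open>The gap between 1 and \<open>2 * d\<^sup>2 - 1\<close>, the lowest height
    reached by rotating \<open>a\<close> about \<open>b\<close>.\<close>
  define e where "e = 2 - 2 * d\<^sup>2"
  have 1: "a \<bullet> a = 1" "b \<bullet> b = 1"
    using is_axis_sphere[OF a] is_axis_sphere[OF b] by (simp_all add: norm_eq_1)
  have "0 < (b - a) \<bullet> (b - a)" "0 < (b + a) \<bullet> (b + a)"
    using ne by (simp_all add: add_eq_0_iff2)
  then have "0 < (1 - d) * (1 + d)"
    by (intro mult_pos_pos) (simp_all add: algebra_simps inner_commute 1 d_def)
  then have e: "e > 0" by (simp add: e_def power2_eq_square algebra_simps)
  have "\<exists>u. is_axis C u \<and> a \<bullet> u = max 0 (1 - 2 ^ n * e)" for n :: nat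
  proof (induction n)
    case 0
    have "2 * (a \<bullet> b)\<^sup>2 - 1 \<le> max 0 (1 - 2 ^ 0 * e)" "max 0 (1 - 2 ^ 0 * e) \<le> 1"
      using e by (simp_all add: e_def d_def)
    with a b show ?case by (meson is_axis_at_height)
  next
    case (Suc n)
    then obtain u where u: "is_axis C u" "a \<bullet> u = max 0 (1 - 2 ^ n * e)" by blast
    define t where "t = 2 ^ n * e"
    have t: "t > 0" using e by (simp add: t_def)
    \<comment> \<open>From height \<open>1 - t\<close> one can descend to
      \<open>1 - 4 * t + 2 * t\<^sup>2\<close>, which for t \<le> 1 is at most
      \<open>1 - 2 * t\<close>: the gap can be doubled exactly. Once truncated at 0, the height can
      stay there.\<close>
    have "2 * (max 0 (1 - t))\<^sup>2 - 1 \<le> max 0 (1 - 2 * t)"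
    proof (cases "t \<le> 1")
      case True
      then have "t * t \<le> t" using t by (simp add: mult_left_le)
      moreover have "2 * (max 0 (1 - t))\<^sup>2 - 1 = 1 - 4 * t + 2 * (t * t)"
        using True by (simp add: power2_eq_square algebra_simps)
      ultimately show ?thesis by linarith
    qed simp
    then have "2 * (a \<bullet> u)\<^sup>2 - 1 \<le> max 0 (1 - 2 ^ Suc n * e)"
      by (simp add: u(2) t_def mult.assoc)
    moreover have "max 0 (1 - 2 ^ Suc n * e) \<le> 1" using e by simp
    ultimately show ?case using a u(1) by (meson is_axis_at_height)
  qed
  moreover obtain n :: nat where "1 / e < 2 ^ n"
    using real_arch_pow[of 2] by auto
  then have "max 0 (1 - 2 ^ n * e) = 0"
    using e by (simp add: field_simps)
  ultimately obtain u where u: "is_axis C u" "a \<bullet> u = 0" by metis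
  \<comment> \<open>An axis orthogonal to \<open>a\<close> makes every height from -1 to 1
    available, in particular that of \<open>y\<close>.\<close>
  have "\<bar>a \<bullet> y\<bar> \<le> 1"
    using Cauchy_Schwarz_ineq2[of a y] is_axis_sphere[OF a] y by simp
  then have "2 * (a \<bullet> u)\<^sup>2 - 1 \<le> a \<bullet> y" "a \<bullet> y \<le> 1" by (simp_all add: u(2))
  then obtain w where w: "is_axis C w" "a \<bullet> w = a \<bullet> y"
    by (rule is_axis_at_height[OF a u(1)])
  obtain \<alpha> where "axial_rotation a \<alpha> w = y"
    using axial_rotation_transitive[OF is_axis_sphere[OF a] is_axis_sphere[OF w(1)] y w(2)]
    by blast
  then show ?thesis using is_axis_axial_rotation[OF a w(1)] by metis
qed

text \<open>One rotation carries \<open>x\<close> to \<open>x'\<close>. A second one, about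
  \<open>x'\<close>, keeps that point fixed and carries the image of \<open>y\<close> to
  \<open>y'\<close>, which lies at the same height over \<open>x'\<close>.\<close>

lemma invariant_pairs:
  assumes axes: "\<And>u. u \<in> \<S>\<^sup>2 \<Longrightarrow> is_axis C u"
    and s: "x \<in> \<S>\<^sup>2" "y \<in> \<S>\<^sup>2" "x' \<in> \<S>\<^sup>2" "y' \<in> \<S>\<^sup>2" and eq: "x \<bullet> y = x' \<bullet> y'"
  shows "C x' y' = C x y"
proof -
  \<comment> \<open>A direction orthogonal to \<open>x - x'\<close> sees both points at the same
    height, so a rotation about it can take one to the other.\<close>
  obtain v where v: "v \<noteq> 0" "orthogonal (x - x') v"
    using orthogonal_to_vector_exists[of "x - x'"] by auto
  define w where "w = v /\<^sub>R norm v"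
  have w: "w \<in> \<S>\<^sup>2" "w \<bullet> x = w \<bullet> x'"
    using v by (simp_all add: w_def orthogonal_def inner_diff_left inner_commute[of v])
  obtain \<alpha> where \<alpha>: "axial_rotation w \<alpha> x = x'"
    using axial_rotation_transitive[OF w(1) s(1) s(3) w(2)] .
  define z where "z = axial_rotation w \<alpha> y"
  have z: "z \<in> \<S>\<^sup>2" unfolding z_def by (rule axial_rotation_sphere[OF w(1) s(2)])
  have "x' \<bullet> z = x' \<bullet> y'"
    using inner_axial_rotation[OF w(1), of \<alpha> x y] eq by (simp add: \<alpha> z_def)
  then obtain \<beta> where \<beta>: "axial_rotation x' \<beta> z = y'"
    using axial_rotation_transitive[OF s(3) z s(4)] by blast
  have "C x' y' = C (axial_rotation x' \<beta> x') (axial_rotation x' \<beta> z)"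
    by (simp add: \<beta> axial_rotation_fixes_axis[OF s(3)])
  also have "\<dots> = C x' z" by (rule is_axisD[OF axes[OF s(3)] s(3) z])
  also have "\<dots> = C x y"
    using is_axisD[OF axes[OF w(1)] s(1,2), of \<alpha>] by (simp add: \<alpha> z_def)
  finally show ?thesis .
qed

theorem theorem5:
  fixes M :: "'a measure" and T :: "real^3 \<Rightarrow> 'a \<Rightarrow> real" and x\<^sub>0 x\<^sub>0' :: "real^3"
  assumes "spherical_random_field M T"
    and "\<not> isotropic M T"
    and "x\<^sub>0 \<in> \<S>\<^sup>2" and "axially_symmetric M T x\<^sub>0"
    and "x\<^sub>0' \<in> \<S>\<^sup>2" and "axially_symmetric M T x\<^sub>0'"
  shows "x\<^sub>0' = x\<^sub>0 \<or> x\<^sub>0' = - x\<^sub>0"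
proof (rule ccontr)
  assume "\<not> ?thesis"
  then have axes: "is_axis (covariance M T) u" if "u \<in> \<S>\<^sup>2" for u
    using is_axis_everywhere is_axis_covariance[OF assms(3,4)] is_axis_covariance[OF assms(5,6)]
      that by blast
  have "isotropic M T"
    unfolding isotropic_def
  proof (intro allI impI ballI)
    fix R :: "real^3^3" and x y :: "real^3"
    assume R: "rotation_matrix R" and xy: "x \<in> \<S>\<^sup>2" "y \<in> \<S>\<^sup>2"
    \<comment> \<open>\<open>R\<close> enters only through its preservation of inner products, which
      is what \<open>invariant_pairs\<close> asks of the two pairs.\<close>
    then have o: "orthogonal_transformation ((*v) R)"
      by (simp add: rotation_matrix_def orthogonal_transformation_matrix)
    have "R *v x \<in> \<S>\<^sup>2" "R *v y \<in> \<S>\<^sup>2"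
      using orthogonal_transformation_norm[OF o] xy by simp_all
    moreover have "x \<bullet> y = (R *v x) \<bullet> (R *v y)"
      using o by (simp add: orthogonal_transformation_def)
    ultimately show "covariance M T (R *v x) (R *v y) = covariance M T x y"
      using invariant_pairs[of "covariance M T", OF axes xy] by blast
  qed
  with assms(2) show False by contradiction
qed

end
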